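(* Let $\mathbf{C} = \mathrm{Av}(312\mid 21)$ and, for $n\ge 0$, let $c_n$ be the number of permutations of length $n$ in $\mathbf{C}$. Then the generating function $s_{\mathbf{C}}(z)=\sum_{n\ge 0} c_n z^n$ is $$s_{\mathbf{C}}(z) = \frac{\left(1+\sqrt{1-4z}\right)\left(1-z-\sqrt{(1-z)(1-5z)}\right)}{4z(1-z)}.$$
   Context: Permutations are written in one-line notation. A permutation (or a sequence of distinct integers) contains a permutation $\tau$ of length $k$ as a pattern if it has a (not necessarily contiguous) subsequence of length $k$ whose entries are in the same relative order as those of $\tau$; otherwise it avoids $\tau$. For a permutation $\alpha$ of length three and a permutation $\beta$ of length two, the juxtaposition class $\mathrm{Av}(\alpha\mid\beta)$ is the set of all permutations $\pi$ whose one-line notation can be written as a concatenation $\pi = AB$ of two (possibly empty) contiguous blocks, such that the prefix $A$ avoids $\alpha$ and the suffix $B$ avoids $\beta$. Thus $\mathrm{Av}(312\mid 21)$ consists of the permutations that are a $312$-avoiding prefix followed by an increasing suffix. Each permutation is counted once, regardless of how many such decompositions it has. The empty permutation (length $0$) is included, so the constant term of the generating function is $1$. Square roots denote the formal power series in $z$ with constant term $1$, and the identity is one of formal power series. *)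

theory Defs
  imports
    "HOL-Computational_Algebra.Formal_Power_Series"
    "HOL-Combinatorics.Multiset_Permutations"
    "HOL-Library.Sublist"
begin

text \<open>
  A permutation of length \<open>n\<close> is given in one-line notation by a list from
  \<^term>\<open>permutations_of_set {1..n}\<close>. Note that \<^const>\<open>subseq\<close> is the not necessarily
  contiguous subsequence relation.
\<close>

definition order_isomorphic :: "nat list \<Rightarrow> nat list \<Rightarrow> bool" where
  "order_isomorphic xs ys \<longleftrightarrow> length xs = length ys \<and>
     (\<forall>i<length xs. \<forall>j<length xs. xs ! i < xs ! j \<longleftrightarrow> ys ! i < ys ! j)"

definition contains_pattern :: "nat list \<Rightarrow> nat list \<Rightarrow> bool" where
  "contains_pattern xs \<tau> \<longleftrightarrow> (\<exists>ys. subseq ys xs \<and> order_isomorphic ys \<tau>)"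

definition avoids :: "nat list \<Rightarrow> nat list \<Rightarrow> bool" where
  "avoids xs \<tau> \<longleftrightarrow> \<not> contains_pattern xs \<tau>"

definition Av_juxt :: "nat list \<Rightarrow> nat list \<Rightarrow> nat list set" where
  "Av_juxt \<alpha> \<beta> = {\<pi>. \<pi> \<in> permutations_of_set {1..length \<pi>} \<and>
     (\<exists>A B. \<pi> = A @ B \<and> avoids A \<alpha> \<and> avoids B \<beta>)}"

definition class_count :: "nat list set \<Rightarrow> nat \<Rightarrow> nat" where
  "class_count C n = card {\<pi> \<in> C. length \<pi> = n}"

definition class_gf :: "nat list set \<Rightarrow> real fps" where
  "class_gf C = Abs_fps (\<lambda>n. real (class_count C n))"

definition fps_sqrt :: "real fps \<Rightarrow> real fps" where
  "fps_sqrt f = fps_radical root 2 f"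

text \<open>For a series with constant term \<open>1\<close> this is the square root with constant term \<open>1\<close>.\<close>

lemma fps_sqrt_unique:
  assumes "fps_nth f 0 = 1"
  shows "r = fps_sqrt f \<longleftrightarrow> r ^ 2 = f \<and> fps_nth r 0 = 1"
proof -
  have "fps_nth (fps_sqrt f) 0 = 1"
    using assms by (simp add: fps_sqrt_def)
  moreover have "fps_sqrt f ^ 2 = f"
    using power_radical[of f root 1] assms by (simp add: fps_sqrt_def numeral_2_eq_2)
  moreover have "r = fps_sqrt f" if "r ^ 2 = f" "fps_nth r 0 = 1"
    using radical_unique[of root 1 f r] assms that by (simp add: fps_sqrt_def numeral_2_eq_2)
  ultimately show ?thesis by blast
qed

lemma fps_X_dvd_if_nth_0:
  fixes f :: "real fps"
  assumes "fps_nth f 0 = 0"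
  shows "fps_X dvd f"
proof (cases "f = 0")
  case False
  then have "subdegree f > 0"
    using assms by (metis gr0I nth_subdegree_nonzero)
  then show ?thesis
    using False by (simp add: fps_dvd_iff)
qed simp

text \<open>
  Division of power series in the library truncates in general. The quotient
  below is exact because the constant term of the numerator vanishes.
\<close>

lemma juxt_quotient_exact:
  "((1 + fps_sqrt (1 - 4 * fps_X)) *
      (1 - fps_X - fps_sqrt ((1 - fps_X) * (1 - 5 * fps_X))) / (4 * fps_X * (1 - fps_X)))
      * (4 * fps_X * (1 - fps_X)) =
   (1 + fps_sqrt (1 - 4 * fps_X)) *
      (1 - fps_X - fps_sqrt ((1 - fps_X) * (1 - 5 * fps_X)))" (is "?N / ?D * ?D = _")
proof (rule dvd_div_mult_self)
  have D0: "?D = fps_X * (4 * (1 - fps_X))" by (simp add: algebra_simps)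
  have u: "is_unit (4 * (1 - fps_X) :: real fps)"
    by simp
  have "fps_nth ?N 0 = 0"
    by (simp add: fps_sqrt_def)
  then have "fps_X dvd ?N"
    by (rule fps_X_dvd_if_nth_0)
  then show "?D dvd ?N"
    using u D0 by (metis mult_unit_dvd_iff)
qed

end

theory Submission
  imports Defs
begin

text \<open>
  A decomposition \<open>\<pi> = AB\<close> of a permutation of a set \<open>S\<close> into a \<open>312\<close>-avoiding prefix and an
  increasing suffix is determined by \<open>A\<close>, because \<open>B\<close> lists the rest of \<open>S\<close> in increasing
  order. So decompositions correspond to \<open>312\<close>-avoiding arrangements of arbitrary subsets of \<open>S\<close>,
  and for \<open>S = {1..n}\<close> there are \<open>g\<^sub>n = (\<Sum>k\<le>n. (n choose k) * catalan k)\<close> of them. A permutation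
  in the class may have several decompositions; it is counted through the one with the shortest
  prefix.

  The prefix is \<^emph>\<open>not\<close> the shortest one exactly if it is nonempty and its last entry \<open>a\<close> is smaller
  than every entry of \<open>B\<close>, for then \<open>a\<close> can be moved to the suffix. As \<open>a\<close> must not play
  the \<open>2\<close> of a \<open>312\<close>, the entries of \<open>A\<close> below \<open>a\<close> all precede those above \<open>a\<close>:
  \<open>A = E D a\<close> with \<open>E < a < D\<close>. Nothing below \<open>a\<close> is left for \<open>B\<close>, so \<open>E\<close> arranges all elements
  below \<open>a\<close>, while \<open>D\<close> arranges an arbitrary subset of the elements above \<open>a\<close>; both avoid
  \<open>312\<close> and are otherwise free (lemma \<open>movable_prefixes_eq_split\<close>). Hence
  \<open>c\<^sub>n = g\<^sub>n - (\<Sum>i<n. catalan i * g\<^sub>n\<^sub>-\<^sub>1\<^sub>-\<^sub>i)\<close>. The same splitting with \<open>B\<close> empty gives the Catalan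
  recurrence for the \<open>312\<close>-avoiding permutations themselves.

  For the generating functions this reads \<open>s = g (1 - z c)\<close>, where \<open>c = 1 + z c\<^sup>2\<close> is the
  Catalan series and \<open>g = c (z / (1 - z)) / (1 - z)\<close> the series of its binomial transform.
  Completing squares in the quadratic equations of \<open>c\<close> and \<open>g\<close> gives
  \<open>\<surd>(1 - 4z) = 1 - 2 z c\<close> and \<open>\<surd>((1 - z)(1 - 5z)) = (1 - z) - 2 z (1 - z) g\<close>, so the numerator
  of the closed form is \<open>4 z (1 - z) (1 - z c) g\<close>.
\<close>

section \<open>The patterns 312 and 21\<close>
lemma order_isomorphic_312_iff:
  "order_isomorphic ys [3, 1, 2] \<longleftrightarrow> (\<exists>c a b. ys = [c, a, b] \<and> a < b \<and> b < c)"
proof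
  assume iso: "order_isomorphic ys [3, 1, 2]"
  then have "length ys = 3"
    by (simp add: order_isomorphic_def)
  then obtain c a b where "ys = [c, a, b]"
    by (auto simp: numeral_3_eq_3 length_Suc_conv)
  with iso show "\<exists>c a b. ys = [c, a, b] \<and> a < b \<and> b < c"
    by (auto simp: order_isomorphic_def numeral_3_eq_3 All_less_Suc2)
next
  assume "\<exists>c a b. ys = [c, a, b] \<and> a < b \<and> b < c"
  then show "order_isomorphic ys [3, 1, 2]"
    by (auto simp: order_isomorphic_def numeral_3_eq_3 less_Suc_eq)
qed

lemma avoids_312_iff:
  "avoids xs [3, 1, 2] \<longleftrightarrow> (\<forall>a b c. a < b \<longrightarrow> b < c \<longrightarrow> \<not> subseq [c, a, b] xs)"
  unfolding avoids_def contains_pattern_def order_isomorphic_312_iff by blast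

lemma order_isomorphic_21_iff:
  "order_isomorphic ys [2, 1] \<longleftrightarrow> (\<exists>b a. ys = [b, a] \<and> a < b)"
proof
  assume iso: "order_isomorphic ys [2, 1]"
  then have "length ys = 2"
    by (simp add: order_isomorphic_def)
  then obtain b a where "ys = [b, a]"
    by (auto simp: numeral_2_eq_2 length_Suc_conv)
  with iso show "\<exists>b a. ys = [b, a] \<and> a < b"
    by (auto simp: order_isomorphic_def numeral_2_eq_2 All_less_Suc2)
next
  assume "\<exists>b a. ys = [b, a] \<and> a < b"
  then show "order_isomorphic ys [2, 1]"
    by (auto simp: order_isomorphic_def numeral_2_eq_2 less_Suc_eq)
qed

lemma subseq_Cons_iff:
  "subseq (x # xs) (y # ys) \<longleftrightarrow> x = y \<and> subseq xs ys \<or> subseq (x # xs) ys"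
  by (metis subseq_Cons2_iff subseq_Cons' list_emb_Cons)

lemma avoids_21_iff_sorted: "avoids xs [2, 1] \<longleftrightarrow> sorted xs"
proof -
  have "(\<forall>a b. a < b \<longrightarrow> \<not> subseq [b, a] xs) \<longleftrightarrow> sorted xs"
  proof (induction xs)
    case (Cons x xs)
    have "(\<forall>a b. a < b \<longrightarrow> \<not> subseq [b, a] (x # xs)) \<longleftrightarrow>
        (\<forall>a\<in>set xs. x \<le> a) \<and> (\<forall>a b. a < b \<longrightarrow> \<not> subseq [b, a] xs)"
      unfolding subseq_Cons_iff subseq_singleton_left using not_le by blast
    with Cons show ?case by simp
  qed simp
  then show ?thesis
    unfolding avoids_def contains_pattern_def order_isomorphic_21_iff by blast
qed

lemma avoids_subseq:
  assumes "avoids ys \<tau>" "subseq xs ys"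
  shows "avoids xs \<tau>"
  using assms subseq_order.order_trans unfolding avoids_def contains_pattern_def by blast

text \<open>
  Consider a \<open>312\<close> pattern that is contained neither in \<open>E\<close> nor in \<open>D\<close>. If its \<open>3\<close> is in \<open>E\<close>, its
  \<open>2\<close> comes after \<open>E\<close> and is too large. Otherwise its \<open>3\<close> and \<open>1\<close> are in \<open>D\<close> and its \<open>2\<close> is \<open>a\<close>,
  which is below the \<open>1\<close>.
\<close>
lemma avoids_312_append_snoc:
  assumes "\<forall>x\<in>set E. x < a" "\<forall>x\<in>set D. a < x"
    and "avoids E [3, 1, 2]" "avoids D [3, 1, 2]"
  shows "avoids (E @ D @ [a]) [3, 1, 2]"
  unfolding avoids_312_iff
proof (intro allI impI notI)
  fix x y c assume lt: "x < y" "y < c" and sub: "subseq [c, x, y] (E @ D @ [a])"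
  obtain p q r where pqr: "[c, x, y] = p @ q @ r" "subseq p E" "subseq q D" "subseq r [a]"
    using sub by (metis subseq_appendE)
  have sets: "set p \<subseteq> set E" "set q \<subseteq> set D" "set r \<subseteq> {a}"
    using pqr(2-4) by (auto dest: list_emb_set)
  have r: "length r \<le> 1"
    using pqr(4) by (auto dest: list_emb_length)
  have np: "[c, x, y] \<noteq> p" and nq: "[c, x, y] \<noteq> q"
    using pqr(2,3) assms(3,4) lt unfolding avoids_312_iff by blast+
  show False
  proof (cases p)
    case Nil
    show False
    proof (cases r)
      case Nil
      with pqr(1) \<open>p = []\<close> nq show False by simp
    next
      case (Cons r0 rs)
      then have "r = [y]" "q = [c, x]"
        using r pqr(1) \<open>p = []\<close> by (auto simp: append_eq_Cons_conv Cons_eq_append_conv)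
      then have "a < x" "y = a" using sets assms(2) by auto
      with lt show False by simp
    qed
  next
    case (Cons c' p')
    then have "c < a" using pqr(1) sets(1) assms(1) by auto
    have "q @ r = []"
    proof (rule ccontr)
      assume "q @ r \<noteq> []"
      then obtain z where z: "z \<in> set (q @ r)" by (meson last_in_set)
      have "z \<in> set [c, x, y]" unfolding pqr(1) using z by auto
      moreover have "a \<le> z" using z sets(2,3) assms(2) by fastforce
      ultimately show False using lt \<open>c < a\<close> by auto
    qed
    with np pqr(1) show False by simp
  qed
qed

text \<open>
  Used with \<open>P\<close> the property of being small: if no large entry precedes a small one, the list
  consists of a block of small entries followed by a block of large ones.
\<close>
lemma filter_append_if_no_inversion:
  assumes "\<And>x y. subseq [y, x] xs \<Longrightarrow> P x \<Longrightarrow> P y"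
  shows "xs = filter P xs @ filter (\<lambda>x. \<not> P x) xs"
  using assms
proof (induction xs)
  case (Cons z xs)
  have IH: "xs = filter P xs @ filter (\<lambda>x. \<not> P x) xs"
    using Cons by (meson list_emb_Cons)
  show ?case
  proof (cases "P z")
    case False
    have "\<not> P x" if "x \<in> set xs" for x
      using Cons.prems[of z x] False that by (auto simp: subseq_singleton_left)
    then show ?thesis
      using False by (auto simp: filter_empty_conv intro: filter_True[symmetric])
  qed (use IH in simp)
qed simp


text \<open>
  An entry above \<open>a\<close> before an entry below \<open>a\<close> would form a \<open>312\<close> with the final \<open>a\<close> as its \<open>2\<close>.
\<close>
lemma avoids_312_snoc_split:
  assumes "avoids (A @ [a]) [3, 1, 2]" "a \<notin> set A"
  shows "A = filter (\<lambda>x. x < a) A @ filter (\<lambda>x. a < x) A"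
proof -
  have "A = filter (\<lambda>x. x < a) A @ filter (\<lambda>x. \<not> x < a) A"
  proof (rule filter_append_if_no_inversion)
    fix b c assume "subseq [c, b] A" "b < a"
    moreover from this have "subseq ([c, b] @ [a]) (A @ [a])"
      by (simp only: subseq_append)
    moreover have "c \<in> set A"
      using \<open>subseq [c, b] A\<close> by (auto dest: list_emb_set[of _ _ _ c])
    ultimately show "c < a"
      using assms unfolding avoids_312_iff by (metis append_Cons append_Nil linorder_neqE_nat)
  qed
  moreover have "filter (\<lambda>x. \<not> x < a) A = filter (\<lambda>x. a < x) A"
    using assms(2) by (intro filter_cong) (auto simp: not_less le_less)
  ultimately show ?thesis by simp
qed

section \<open>Splitting arrangements at their last entry\<close>
definition av312 :: "nat set \<Rightarrow> nat list set" where
  "av312 S = {xs. distinct xs \<and> set xs = S \<and> avoids xs [3, 1, 2]}"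

text \<open>
  These lists encode the decompositions of the permutations of \<open>S\<close>: such a list is the prefix, and
  the suffix lists the remaining elements of \<open>S\<close> in increasing order.
\<close>
definition partial_av312 :: "nat set \<Rightarrow> nat list set" where
  "partial_av312 S = (\<Union>T\<in>Pow S. av312 T)"

lemma in_partial_av312_iff:
  "xs \<in> partial_av312 S \<longleftrightarrow> distinct xs \<and> set xs \<subseteq> S \<and> avoids xs [3, 1, 2]"
  by (auto simp: partial_av312_def av312_def)

lemma finite_av312: "finite (av312 S)"
  by (rule finite_subset[OF _ finite_permutations_of_set[of S]])
     (auto simp: av312_def permutations_of_set_def)

lemma finite_partial_av312: "finite S \<Longrightarrow> finite (partial_av312 S)"
  by (simp add: partial_av312_def finite_av312)

text \<open>
  The families \<open>P\<close> and \<open>Q\<close> are parameters because two choices occur: with \<^const>\<open>av312\<close> on both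
  sides all \<open>312\<close>-avoiding arrangements of \<open>S\<close> arise, and with \<^const>\<open>partial_av312\<close> on the right
  those prefixes whose last entry can be moved to the suffix.
\<close>
definition split_by_last ::
  "(nat set \<Rightarrow> nat list set) \<Rightarrow> (nat set \<Rightarrow> nat list set) \<Rightarrow> nat set \<Rightarrow> nat list set" where
  "split_by_last P Q S =
     (\<Union>a\<in>S. (\<lambda>(E, D). E @ D @ [a]) ` (P {x \<in> S. x < a} \<times> Q {x \<in> S. a < x}))"

lemma split_by_lastI:
  assumes "a \<in> S" "E \<in> P {x \<in> S. x < a}" "D \<in> Q {x \<in> S. a < x}"
  shows "E @ D @ [a] \<in> split_by_last P Q S"
proof -
  have "(\<lambda>(E, D). E @ D @ [a]) (E, D) \<in> split_by_last P Q S"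
    unfolding split_by_last_def using assms by (intro UN_I[of a] imageI) auto
  then show ?thesis by simp
qed

lemma av312_eq_split:
  assumes "S \<noteq> {}"
  shows "av312 S = split_by_last av312 av312 S"
proof (intro equalityI subsetI)
  fix xs assume xs: "xs \<in> av312 S"
  then have "xs \<noteq> []" using assms by (auto simp: av312_def)
  then obtain A a where A: "xs = A @ [a]" by (metis rev_exhaust)
  define E D where "E = filter (\<lambda>x. x < a) A" and "D = filter (\<lambda>x. a < x) A"
  have "avoids (A @ [a]) [3, 1, 2]" "distinct A" "a \<notin> set A" "S = insert a (set A)"
    using xs A by (auto simp: av312_def)
  moreover have "subseq E (A @ [a])" "subseq D (A @ [a])"
    by (auto simp: E_def D_def)
  then have "avoids E [3, 1, 2]" "avoids D [3, 1, 2]"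
    using avoids_subseq[OF \<open>avoids (A @ [a]) [3, 1, 2]\<close>] by simp_all
  ultimately have "E \<in> av312 {x \<in> S. x < a}" "D \<in> av312 {x \<in> S. a < x}" "a \<in> S"
    by (auto simp: av312_def E_def D_def)
  moreover have "A = E @ D"
    unfolding E_def D_def by (rule avoids_312_snoc_split) fact+
  ultimately show "xs \<in> split_by_last av312 av312 S"
    using split_by_lastI[of a S E av312 D av312] \<open>a \<in> S\<close> A by (metis append_assoc)
next
  fix xs assume "xs \<in> split_by_last av312 av312 S"
  then obtain a E D where xs: "xs = E @ D @ [a]" "a \<in> S"
    and E: "distinct E" "set E = {x \<in> S. x < a}" "avoids E [3, 1, 2]"
    and D: "distinct D" "set D = {x \<in> S. a < x}" "avoids D [3, 1, 2]"
    by (auto simp: split_by_last_def av312_def)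
  have "avoids xs [3, 1, 2]"
    unfolding xs using E D by (intro avoids_312_append_snoc) auto
  moreover have "set E \<inter> set D = {}" "a \<notin> set E" "a \<notin> set D"
    unfolding E(2) D(2) by auto
  then have "distinct xs" using xs(1) E(1) D(1) by simp
  moreover have "set xs = S"
    unfolding xs(1) set_append E(2) D(2) using \<open>a \<in> S\<close> by (auto simp: not_less_iff_gr_or_eq)
  ultimately show "xs \<in> av312 S" by (simp add: av312_def)
qed

text \<open>
  The condition on the left says that the last entry \<open>a\<close> can be put in front of the increasing list of
  the remaining elements. It forces every element of \<open>S\<close> below \<open>a\<close> into \<open>A\<close>, but leaves
  open which of the elements above \<open>a\<close> belong to \<open>A\<close>.
\<close>
lemma movable_prefixes_eq_split:
  "{A \<in> partial_av312 S. A \<noteq> [] \<and> (\<forall>x\<in>S - set A. last A < x)} =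
     split_by_last av312 partial_av312 S"
proof (intro equalityI subsetI)
  fix xs assume xs: "xs \<in> {A \<in> partial_av312 S. A \<noteq> [] \<and> (\<forall>x\<in>S - set A. last A < x)}"
  then obtain A a where A: "xs = A @ [a]" by (metis (mono_tags, lifting) mem_Collect_eq rev_exhaust)
  define E D where "E = filter (\<lambda>x. x < a) A" and "D = filter (\<lambda>x. a < x) A"
  have "avoids (A @ [a]) [3, 1, 2]" "distinct A" "a \<notin> set A" "a \<in> S" "set A \<subseteq> S"
    and least: "\<forall>x\<in>S - set A - {a}. a < x"
    using xs A by (auto simp: in_partial_av312_iff)
  moreover have "set E = {x \<in> S. x < a}"
  proof -
    have "x \<in> set A" if "x \<in> S" "x < a" for x
    proof (rule ccontr)
      assume "x \<notin> set A"
      with that have "x \<in> S - set A - {a}" by simp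
      with least have "a < x" by blast
      with that show False by simp
    qed
    with \<open>set A \<subseteq> S\<close> show ?thesis by (auto simp: E_def)
  qed
  moreover have "subseq E (A @ [a])" "subseq D (A @ [a])"
    by (auto simp: E_def D_def)
  then have "avoids E [3, 1, 2]" "avoids D [3, 1, 2]"
    using avoids_subseq[OF \<open>avoids (A @ [a]) [3, 1, 2]\<close>] by simp_all
  ultimately have "E \<in> av312 {x \<in> S. x < a}" "D \<in> partial_av312 {x \<in> S. a < x}"
    by (auto simp: av312_def in_partial_av312_iff E_def D_def)
  moreover have "A = E @ D"
    unfolding E_def D_def by (rule avoids_312_snoc_split) fact+
  ultimately show "xs \<in> split_by_last av312 partial_av312 S"
    using split_by_lastI[of a S E av312 D partial_av312] \<open>a \<in> S\<close> A by (metis append_assoc)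
next
  fix xs assume "xs \<in> split_by_last av312 partial_av312 S"
  then obtain a E D where xs: "xs = E @ D @ [a]" "a \<in> S"
    and E: "distinct E" "set E = {x \<in> S. x < a}" "avoids E [3, 1, 2]"
    and D: "distinct D" "set D \<subseteq> {x \<in> S. a < x}" "avoids D [3, 1, 2]"
    by (auto simp: split_by_last_def av312_def in_partial_av312_iff)
  have "avoids xs [3, 1, 2]"
    unfolding xs using E D by (intro avoids_312_append_snoc) auto
  moreover have "distinct xs" "set xs \<subseteq> S" using xs E D by auto
  moreover have "a < x" if "x \<in> S - set xs" for x
    using that xs E(2) by (cases x a rule: linorder_cases) auto
  ultimately show "xs \<in> {A \<in> partial_av312 S. A \<noteq> [] \<and> (\<forall>x\<in>S - set A. last A < x)}"
    using xs by (auto simp: in_partial_av312_iff)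
qed

section \<open>Counting arrangements\<close>
text \<open>
  Replacing an element by its rank makes the counts below depend on the size of \<open>S\<close> only, so that
  arrangements never have to be relabelled.
\<close>
lemma sum_over_ranks:
  fixes S :: "'a :: linorder set" and f :: "nat \<Rightarrow> nat \<Rightarrow> 'b :: comm_monoid_add"
  assumes "finite S"
  shows "(\<Sum>a\<in>S. f (card {x \<in> S. x < a}) (card {x \<in> S. a < x})) =
    (\<Sum>i<card S. f i (card S - 1 - i))"
proof -
  define rank where "rank = (\<lambda>a. card {x \<in> S. x < a})"
  have mono: "rank a < rank b" if "a \<in> S" "a < b" for a b
    unfolding rank_def using assms that by (intro psubset_card_mono psubsetI) auto
  have above: "card {x \<in> S. a < x} = card S - 1 - rank a" and below: "rank a < card S"
    if a: "a \<in> S" for a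
  proof -
    have "S = insert a ({x \<in> S. x < a} \<union> {x \<in> S. a < x})" using a by auto
    then have "card S = card (insert a ({x \<in> S. x < a} \<union> {x \<in> S. a < x}))" by simp
    also have "\<dots> = Suc (rank a + card {x \<in> S. a < x})"
      unfolding rank_def using assms by (subst card_insert_disjoint) (auto intro!: card_Un_disjoint)
    finally show "card {x \<in> S. a < x} = card S - 1 - rank a" "rank a < card S" by auto
  qed
  have inj: "inj_on rank S"
    by (rule inj_onI) (metis mono less_irrefl linorder_neqE)
  have "rank ` S = {..<card S}"
    by (rule card_subset_eq) (use below inj in \<open>auto simp: card_image\<close>)
  then have "(\<Sum>i<card S. f i (card S - 1 - i)) = (\<Sum>a\<in>S. f (rank a) (card S - 1 - rank a))"
    using sum.reindex[OF inj, of "\<lambda>i. f i (card S - 1 - i)"] by simp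
  also have "\<dots> = (\<Sum>a\<in>S. f (card {x \<in> S. x < a}) (card {x \<in> S. a < x}))"
    by (rule sum.cong) (auto simp: above, simp add: rank_def)
  finally show ?thesis by simp
qed

text \<open>
  The triple \<open>(a, E, D)\<close> can be read off from the list: \<open>a\<close> is its last entry, and \<open>E\<close> and \<open>D\<close>
  are its entries below and above \<open>a\<close>.
\<close>
lemma card_split_by_last:
  assumes S: "finite S"
    and P: "\<And>T xs. xs \<in> P T \<Longrightarrow> set xs \<subseteq> T" and Q: "\<And>T xs. xs \<in> Q T \<Longrightarrow> set xs \<subseteq> T"
    and finite: "\<And>T. T \<subset> S \<Longrightarrow> finite (P T)" "\<And>T. T \<subset> S \<Longrightarrow> finite (Q T)"
    and p: "\<And>T. T \<subset> S \<Longrightarrow> card (P T) = p (card T)"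
    and q: "\<And>T. T \<subset> S \<Longrightarrow> card (Q T) = q (card T)"
  shows "card (split_by_last P Q S) = (\<Sum>i<card S. p i * q (card S - 1 - i))"
proof -
  let ?f = "\<lambda>a (E, D). E @ D @ [a]" and ?l = "\<lambda>a. {x \<in> S. x < a}" and ?u = "\<lambda>a. {x \<in> S. a < x}"
  have inj: "inj_on (?f a) (P (?l a) \<times> Q (?u a))" for a
  proof (rule inj_on_inverseI)
    fix ED assume "ED \<in> P (?l a) \<times> Q (?u a)"
    then obtain E D where ED: "ED = (E, D)" "set E \<subseteq> ?l a" "set D \<subseteq> ?u a"
      using P Q by force
    then have "filter (\<lambda>x. x < a) E = E" "filter (\<lambda>x. a < x) E = []"
      "filter (\<lambda>x. x < a) D = []" "filter (\<lambda>x. a < x) D = D"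
      by (auto simp: filter_id_conv filter_empty_conv)
    with ED(1) show "(\<lambda>xs. (filter (\<lambda>x. x < a) xs, filter (\<lambda>x. a < x) xs)) (?f a ED) = ED"
      by simp
  qed
  have sub: "?l a \<subset> S" "?u a \<subset> S" if "a \<in> S" for a using that by auto
  have "card (split_by_last P Q S) = (\<Sum>a\<in>S. card (?f a ` (P (?l a) \<times> Q (?u a))))"
    unfolding split_by_last_def using S finite sub by (intro card_UN_disjoint) auto
  also have "\<dots> = (\<Sum>a\<in>S. p (card (?l a)) * q (card (?u a)))"
    using sub by (intro sum.cong) (auto simp: card_image[OF inj] card_cartesian_product p q)
  also have "\<dots> = (\<Sum>i<card S. p i * q (card S - 1 - i))"
    using S by (rule sum_over_ranks)
  finally show ?thesis .
qed

fun catalan :: "nat \<Rightarrow> nat" where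
  "catalan 0 = 1"
| "catalan (Suc n) = (\<Sum>i<Suc n. catalan i * catalan (n - i))"

lemma card_av312: "finite S \<Longrightarrow> card (av312 S) = catalan (card S)"
proof (induction S rule: finite_psubset_induct)
  case (psubset S)
  show ?case
  proof (cases "S = {}")
    case True
    have "av312 {} = {[]}" unfolding av312_def avoids_312_iff by auto
    with True show ?thesis by simp
  next
    case False
    then obtain n where n: "card S = Suc n"
      using psubset.hyps by (cases "card S") auto
    have "card (av312 S) = (\<Sum>i<card S. catalan i * catalan (card S - 1 - i))"
      unfolding av312_eq_split[OF False]
    proof (rule card_split_by_last)
      show "set xs \<subseteq> T" "set xs \<subseteq> T" if "xs \<in> av312 T" for xs T
        using that by (simp_all add: av312_def)
    qed (use psubset in \<open>simp_all only: finite_av312\<close>)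
    then show ?thesis by (simp add: n)
  qed
qed

definition binomial_catalan :: "nat \<Rightarrow> nat" where
  "binomial_catalan n = (\<Sum>k\<le>n. (n choose k) * catalan k)"

lemma card_partial_av312:
  assumes "finite S"
  shows "card (partial_av312 S) = binomial_catalan (card S)"
proof -
  have "card (partial_av312 S) = (\<Sum>T\<in>Pow S. card (av312 T))"
    unfolding partial_av312_def using assms
    by (intro card_UN_disjoint) (auto simp: finite_av312, auto simp: av312_def)
  also have "\<dots> = (\<Sum>T\<in>Pow S. catalan (card T))"
    using assms by (intro sum.cong) (auto intro: card_av312 finite_subset)
  also have "\<dots> = (\<Sum>k\<le>card S. \<Sum>T\<in>{T \<in> Pow S. card T = k}. catalan (card T))"
    using assms by (intro sum.group[symmetric]) (auto intro: card_mono)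
  also have "\<dots> = binomial_catalan (card S)"
    unfolding binomial_catalan_def using n_subsets[OF assms] by (intro sum.cong) auto
  finally show ?thesis .
qed

section \<open>The shortest prefix of a permutation in the class\<close>
text \<open>
  The entries of \<open>A\<close> beyond \<open>A'\<close> are part of the increasing suffix that belongs to \<open>A'\<close>. As \<open>A\<close>
  ends with such an entry, that entry is below everything after \<open>A\<close>. This yields the uniqueness
  of a decomposition whose prefix cannot be shortened by its last entry.
\<close>
lemma last_below_if_longer_prefix:
  assumes S: "finite S" "set A \<subseteq> S" "distinct A"
    and eq: "A @ sorted_list_of_set (S - set A) = A' @ sorted_list_of_set (S - set A')"
    and longer: "length A' < length A"
  shows "A \<noteq> [] \<and> (\<forall>x\<in>S - set A. last A < x)"
proof -
  define B B' where "B = sorted_list_of_set (S - set A)" and "B' = sorted_list_of_set (S - set A')"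
  have "A @ B = A' @ B'" using eq by (simp only: B_def B'_def)
  then obtain us where "A = A' @ us \<and> us @ B = B' \<or> A @ us = A' \<and> B = us @ B'"
    unfolding append_eq_append_conv2 by blast
  then have us: "A = A' @ us" "B' = us @ B" "us \<noteq> []" using longer by auto
  then have last: "last A \<in> set us" by simp
  have "sorted (us @ B)" unfolding us(2)[symmetric] B'_def by simp
  then have "last A \<le> x" if "x \<in> set B" for x
    using that last by (simp add: sorted_append)
  moreover have "set B = S - set A" using S(1) by (simp add: B_def)
  moreover have "last A \<in> set A" using last us(1) by simp
  ultimately have "last A < x" if "x \<in> S - set A" for x
    using that by (cases "x = last A") (auto simp: less_le)
  then show ?thesis using us(1,3) by simp
qed

lemma Av_juxt_312_21_iff:
  "\<pi> \<in> Av_juxt [3, 1, 2] [2, 1] \<and> length \<pi> = n \<longleftrightarrow>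
     set \<pi> = {1..n} \<and> distinct \<pi> \<and> (\<exists>A B. \<pi> = A @ B \<and> avoids A [3, 1, 2] \<and> sorted B)"
proof -
  have "length \<pi> = n" if "set \<pi> = {1..n}" "distinct \<pi>"
    using distinct_card[OF that(2)] that(1) by simp
  then show ?thesis
    unfolding Av_juxt_def permutations_of_set_def avoids_21_iff_sorted by blast
qed

text \<open>
  Each permutation in the class has exactly one decomposition whose last prefix entry cannot be moved to
  the suffix: the one with the shortest prefix.
\<close>
lemma bij_betw_shortest_prefix:
  "bij_betw (\<lambda>A. A @ sorted_list_of_set ({1..n} - set A))
     {A \<in> partial_av312 {1..n}. \<not> (A \<noteq> [] \<and> (\<forall>x\<in>{1..n} - set A. last A < x))}
     {\<pi> \<in> Av_juxt [3, 1, 2] [2, 1]. length \<pi> = n}"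
    (is "bij_betw ?f ?canonical ?class")
proof (rule bij_betw_imageI)
  show "inj_on ?f ?canonical"
  proof (rule inj_onI)
    fix A A' assume A: "A \<in> ?canonical" and A': "A' \<in> ?canonical" and eq: "?f A = ?f A'"
    have "length A = length A'"
    proof (cases "length A" "length A'" rule: linorder_cases)
      case less
      have "A' \<noteq> [] \<and> (\<forall>x\<in>{1..n} - set A'. last A' < x)"
        by (rule last_below_if_longer_prefix[OF _ _ _ eq[symmetric] less])
           (use A' in \<open>auto simp: in_partial_av312_iff\<close>)
      with A' show ?thesis by blast
    next
      case greater
      have "A \<noteq> [] \<and> (\<forall>x\<in>{1..n} - set A. last A < x)"
        by (rule last_below_if_longer_prefix[OF _ _ _ eq greater])
           (use A in \<open>auto simp: in_partial_av312_iff\<close>)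
      with A show ?thesis by blast
    qed
    with eq show "A = A'" by simp
  qed
  show "?f ` ?canonical = ?class"
  proof (intro equalityI subsetI)
    fix \<pi> assume "\<pi> \<in> ?f ` ?canonical"
    then obtain A where A: "\<pi> = ?f A" "distinct A" "set A \<subseteq> {1..n}" "avoids A [3, 1, 2]"
      by (auto simp: in_partial_av312_iff)
    then have "set \<pi> = {1..n}" "distinct \<pi>" by auto
    moreover have "sorted (sorted_list_of_set ({1..n} - set A))" by simp
    ultimately show "\<pi> \<in> ?class"
      using A(1,4) Av_juxt_312_21_iff[of \<pi> n] by blast
  next
    fix \<pi> assume "\<pi> \<in> ?class"
    then have perm: "set \<pi> = {1..n}" "distinct \<pi>"
      and ex: "\<exists>A B. \<pi> = A @ B \<and> avoids A [3, 1, 2] \<and> sorted B"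
      using Av_juxt_312_21_iff[of \<pi> n] by blast+
    \<comment> \<open>The required prefix ends at the least position at which \<open>\<pi>\<close> can be cut.\<close>
    define cut where "cut k \<longleftrightarrow> avoids (take k \<pi>) [3, 1, 2] \<and> sorted (drop k \<pi>)" for k
    from ex obtain k0 where "cut k0"
      unfolding cut_def by (metis append_eq_conv_conj)
    define k where "k = (LEAST k. cut k)"
    have k: "cut k"
      unfolding k_def using \<open>cut k0\<close> by (rule LeastI)
    have least: "\<not> cut j" if "j < k" for j
      using that unfolding k_def by (rule not_less_Least)
    define A where "A = take k \<pi>"
    have AB: "\<pi> = A @ drop k \<pi>" by (simp add: A_def)
    then have "distinct A" "distinct (drop k \<pi>)" "set A \<inter> set (drop k \<pi>) = {}"
      "set A \<union> set (drop k \<pi>) = {1..n}"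
      using perm by (metis distinct_append set_append)+
    then have "{1..n} - set A = set (drop k \<pi>)" by blast
    then have "drop k \<pi> = sorted_list_of_set ({1..n} - set A)"
      using k \<open>distinct (drop k \<pi>)\<close>
      by (simp add: cut_def sorted_list_of_set.idem_if_sorted_distinct)
    then have "\<pi> = ?f A" using AB by simp
    moreover have "\<not> (A \<noteq> [] \<and> (\<forall>x\<in>{1..n} - set A. last A < x))"
    proof
      assume *: "A \<noteq> [] \<and> (\<forall>x\<in>{1..n} - set A. last A < x)"
      then obtain A' a where A': "A = A' @ [a]" by (metis rev_exhaust)
      have "\<pi> = A' @ a # drop k \<pi>" using AB A' by simp
      moreover have "length A' < k"
        using A' by (auto simp: A_def dest: arg_cong[of _ _ length])
      moreover have "avoids A' [3, 1, 2]"
        by (rule avoids_subseq[of "take k \<pi>"]) (use k A' in \<open>auto simp: cut_def A_def\<close>)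
      moreover have "sorted (a # drop k \<pi>)"
        using * A' k \<open>{1..n} - set A = set (drop k \<pi>)\<close> by (auto simp: cut_def intro: less_imp_le)
      ultimately have "cut (length A')"
        unfolding cut_def by (metis append_eq_conv_conj)
      with least \<open>length A' < k\<close> show False by blast
    qed
    moreover have "A \<in> partial_av312 {1..n}"
      using k \<open>distinct A\<close> \<open>set A \<union> set (drop k \<pi>) = {1..n}\<close>
      by (auto simp: in_partial_av312_iff cut_def A_def)
    ultimately show "\<pi> \<in> ?f ` ?canonical" by blast
  qed
qed

text \<open>
  All decompositions fall into those with the shortest prefix, one for each permutation in the
  class, and those whose prefix can be shortened, which the sum counts.
\<close>
lemma class_count_recurrence:
  "class_count (Av_juxt [3, 1, 2] [2, 1]) n + (\<Sum>i<n. catalan i * binomial_catalan (n - 1 - i)) =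
     binomial_catalan n"
proof -
  let ?P = "partial_av312 {1..n}" and ?M = "\<lambda>A. A \<noteq> [] \<and> (\<forall>x\<in>{1..n} - set A. last A < x)"
  have fin: "finite ?P" by (simp add: finite_partial_av312)
  have "card {A \<in> ?P. ?M A} = (\<Sum>i<card {1..n}. catalan i * binomial_catalan (card {1..n} - 1 - i))"
    unfolding movable_prefixes_eq_split
  proof (rule card_split_by_last)
    fix T assume "T \<subset> {1..n}"
    then have "finite T" by (meson finite_atLeastAtMost finite_subset psubset_imp_subset)
    then show "finite (av312 T)" "finite (partial_av312 T)"
      "card (av312 T) = catalan (card T)" "card (partial_av312 T) = binomial_catalan (card T)"
      by (simp_all add: finite_av312 finite_partial_av312 card_av312 card_partial_av312)
  qed (auto simp: av312_def in_partial_av312_iff)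
  moreover have "card {A \<in> ?P. \<not> ?M A} = class_count (Av_juxt [3, 1, 2] [2, 1]) n"
    unfolding class_count_def by (rule bij_betw_same_card[OF bij_betw_shortest_prefix])
  moreover have "card ?P = card {A \<in> ?P. ?M A} + card {A \<in> ?P. \<not> ?M A}"
    using fin by (subst card_Un_disjoint[symmetric]) (auto intro: arg_cong[of _ _ card])
  ultimately show ?thesis
    using card_partial_av312[of "{1..n}"] by simp
qed

section \<open>Generating functions\<close>
definition catalan_gf :: "real fps" where
  "catalan_gf = Abs_fps (\<lambda>n. real (catalan n))"

definition binomial_catalan_gf :: "real fps" where
  "binomial_catalan_gf = Abs_fps (\<lambda>n. real (binomial_catalan n))"

unbundle fps_syntax

lemma fps_X_mult_mult_nth:
  "(fps_X * (f * g)) $ n = (\<Sum>i<n. f $ i * g $ (n - 1 - i))" for f g :: "real fps"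
  unfolding fps_X_mult_nth fps_mult_nth[of f g]
  by (cases n) (simp_all add: lessThan_Suc_atMost atLeast0AtMost)

lemma catalan_gf_eq: "catalan_gf = 1 + fps_X * (catalan_gf * catalan_gf)"
proof (rule fps_ext)
  fix n show "catalan_gf $ n = (1 + fps_X * (catalan_gf * catalan_gf)) $ n"
    unfolding fps_add_nth fps_X_mult_mult_nth by (cases n) (simp_all add: catalan_gf_def)
qed

lemma class_gf_eq:
  "class_gf (Av_juxt [3, 1, 2] [2, 1]) = binomial_catalan_gf * (1 - fps_X * catalan_gf)"
proof -
  have "class_gf (Av_juxt [3, 1, 2] [2, 1]) + fps_X * (catalan_gf * binomial_catalan_gf) =
      binomial_catalan_gf"
  proof (rule fps_ext)
    fix n
    show "(class_gf (Av_juxt [3, 1, 2] [2, 1]) + fps_X * (catalan_gf * binomial_catalan_gf)) $ n =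
        binomial_catalan_gf $ n"
      unfolding fps_add_nth fps_X_mult_mult_nth
      using arg_cong[OF class_count_recurrence[of n], of real]
      by (simp add: class_gf_def catalan_gf_def binomial_catalan_gf_def)
  qed
  then show ?thesis by (simp add: algebra_simps)
qed

text \<open>
  By Pascal's rule, the series of column \<open>k + 1\<close> of Pascal's triangle arises from that of column \<open>k\<close>
  by multiplication with \<open>z / (1 - z)\<close>.
\<close>
lemma binomial_column_gf:
  "(1 - fps_X) * Abs_fps (\<lambda>n. real (n choose k)) = (fps_X * inverse (1 - fps_X)) ^ k"
proof (induction k)
  case 0
  show ?case by (rule fps_ext) (simp add: algebra_simps split: nat.split)
next
  case (Suc k)
  let ?F = "\<lambda>k. Abs_fps (\<lambda>n. real (n choose k))"
  have unit: "inverse (1 - fps_X) * (1 - fps_X) = (1 :: real fps)"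
    by (rule inverse_mult_eq_1) simp
  have "(1 - fps_X) * ?F (Suc k) = fps_X * ?F k"
  proof (rule fps_ext)
    fix n show "((1 - fps_X) * ?F (Suc k)) $ n = (fps_X * ?F k) $ n"
      by (cases n) (simp_all add: left_diff_distrib)
  qed
  also have "\<dots> = fps_X * inverse (1 - fps_X) * ((1 - fps_X) * ?F k)"
    using unit by (simp add: mult.assoc[symmetric])
  finally show ?case by (simp add: Suc.IH)
qed

text \<open>
  The binomial transform is the sum over \<open>k\<close> of \<open>catalan k\<close> times column \<open>k\<close> of Pascal's triangle.
\<close>
lemma binomial_catalan_gf_compose:
  "(1 - fps_X) * binomial_catalan_gf = catalan_gf oo (fps_X * inverse (1 - fps_X))"
proof (rule fps_ext)
  fix n
  let ?F = "\<lambda>k. Abs_fps (\<lambda>n. real (n choose k))"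
  \<comment> \<open>Columns \<open>k > n\<close> start beyond degree \<open>n\<close>, so up to that degree a finite sum suffices.\<close>
  let ?G = "\<Sum>k\<le>n. fps_const (real (catalan k)) * ?F k"
  have G: "binomial_catalan_gf $ m = ?G $ m" if "m \<le> n" for m
  proof -
    have "(\<Sum>k\<le>m. real (catalan k) * real (m choose k)) =
        (\<Sum>k\<le>n. real (catalan k) * real (m choose k))"
      using that by (intro sum.mono_neutral_left) auto
    then show ?thesis
      by (simp add: binomial_catalan_gf_def binomial_catalan_def fps_sum_nth mult.commute)
  qed
  have "((1 - fps_X) * binomial_catalan_gf) $ n = ((1 - fps_X) * ?G) $ n"
    using G by (simp add: fps_mult_nth)
  also have "(1 - fps_X) * ?G = (\<Sum>k\<le>n. fps_const (real (catalan k)) * ((1 - fps_X) * ?F k))"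
    by (simp add: sum_distrib_left mult.left_commute)
  also have "\<dots> $ n = (catalan_gf oo (fps_X * inverse (1 - fps_X))) $ n"
    unfolding binomial_column_gf
    by (simp add: fps_sum_nth fps_compose_nth catalan_gf_def atLeast0AtMost)
  finally show "((1 - fps_X) * binomial_catalan_gf) $ n =
    (catalan_gf oo (fps_X * inverse (1 - fps_X))) $ n" .
qed

text \<open>
  Substituting \<open>z / (1 - z)\<close> for \<open>z\<close> in the Catalan equation \<open>c = 1 + z c\<^sup>2\<close>, where \<open>c\<close> becomes
  \<open>(1 - z) g\<close>.
\<close>
lemma binomial_catalan_gf_eq:
  "(1 - fps_X) * binomial_catalan_gf =
     1 + fps_X * (1 - fps_X) * (binomial_catalan_gf * binomial_catalan_gf)"
proof -
  let ?u = "inverse (1 - fps_X) :: real fps" and ?g = binomial_catalan_gf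
  have unit: "?u * (1 - fps_X) = 1"
    by (rule inverse_mult_eq_1) simp
  have t0: "(fps_X * ?u) $ 0 = 0" by simp
  have "(1 - fps_X) * ?g = (1 + fps_X * (catalan_gf * catalan_gf)) oo (fps_X * ?u)"
    unfolding binomial_catalan_gf_compose using catalan_gf_eq by simp
  also have "\<dots> = 1 + fps_X * ?u * (((1 - fps_X) * ?g) * ((1 - fps_X) * ?g))"
    unfolding binomial_catalan_gf_compose
    by (simp add: fps_compose_add_distrib fps_compose_mult_distrib[OF t0])
  also have "\<dots> = 1 + (?u * (1 - fps_X)) * (fps_X * (1 - fps_X) * (?g * ?g))"
    by (simp only: ac_simps)
  finally show ?thesis unfolding unit by simp
qed

lemma fps_sqrt_eqI: "r ^ 2 = f \<Longrightarrow> r $ 0 = 1 \<Longrightarrow> fps_sqrt f = r"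
  using fps_sqrt_unique[of f r] by (auto simp: power2_eq_square)

lemma fps_sqrt_catalan: "fps_sqrt (1 - 4 * fps_X) = 1 - 2 * fps_X * catalan_gf"
proof (rule fps_sqrt_eqI)
  have "(1 - 2 * fps_X * catalan_gf) ^ 2 =
      1 - 4 * fps_X * (catalan_gf - fps_X * (catalan_gf * catalan_gf))"
    by (simp add: power2_eq_square algebra_simps)
  moreover have "catalan_gf - fps_X * (catalan_gf * catalan_gf) = 1"
    using catalan_gf_eq by (simp add: diff_eq_eq)
  ultimately show "(1 - 2 * fps_X * catalan_gf) ^ 2 = 1 - 4 * fps_X"
    by simp
qed simp

lemma fps_sqrt_binomial_catalan:
  "fps_sqrt ((1 - fps_X) * (1 - 5 * fps_X)) =
     (1 - fps_X) - 2 * fps_X * (1 - fps_X) * binomial_catalan_gf" (is "_ = ?r")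
proof (rule fps_sqrt_eqI)
  let ?g = binomial_catalan_gf
  have "?r ^ 2 = (1 - fps_X) * ((1 - fps_X) -
      4 * fps_X * ((1 - fps_X) * ?g - fps_X * (1 - fps_X) * (?g * ?g)))"
    by (simp add: power2_eq_square algebra_simps)
  also have "(1 - fps_X) * ?g - fps_X * (1 - fps_X) * (?g * ?g) = 1"
    unfolding binomial_catalan_gf_eq by simp
  also have "(1 - fps_X) - 4 * fps_X * 1 = (1 - 5 * fps_X :: real fps)"
    by simp
  finally show "?r ^ 2 = (1 - fps_X) * (1 - 5 * fps_X)" .
qed simp

theorem theorem3:
  shows "class_gf (Av_juxt [3, 1, 2] [2, 1]) =
    (1 + fps_sqrt (1 - 4 * fps_X)) *
      (1 - fps_X - fps_sqrt ((1 - fps_X) * (1 - 5 * fps_X)))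
    / (4 * fps_X * (1 - fps_X))"
    (is "?s = ?N / ?D")
proof -
  have "?N / ?D * ?D = ?N" by (rule juxt_quotient_exact)
  also have "?N = ?s * ?D"
    unfolding fps_sqrt_catalan fps_sqrt_binomial_catalan class_gf_eq
    by (simp add: algebra_simps)
  finally have "?N / ?D * ?D = ?s * ?D" .
  moreover have "?D \<noteq> 0"
  proof
    assume "?D = 0"
    then have "?D $ 1 = 0" by simp
    then show False by (simp add: mult.assoc)
  qed
  ultimately show ?thesis by simp
qed

end
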